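(* For every bunch of formulae $\Gamma \in \mathcal{B}(\mathbb{F})$ and every formula $\varphi \in \mathbb{F}$: if $\Gamma \Vdash \varphi$ (i.e. the sequent $\Gamma\triangleright\varphi$ is valid in the base-extension semantics), then $\Gamma \vdash \varphi$ (i.e. the sequent $\Gamma \triangleright \varphi$ is provable in the natural deduction system $\mathsf{NBI}$).
   Context: **Syntax.** Fix a denumerable (countably infinite) set $\mathbb{A}$ of atoms. The set $\mathbb{F}$ of formulae of the logic of bunched implications (BI) is generated by $\varphi ::= p\in\mathbb{A} \mid \top \mid \bot \mid \top^{\ast} \mid \varphi\land\varphi \mid \varphi\lor\varphi \mid \varphi\to\varphi \mid \varphi\ast\varphi \mid \varphi\mathbin{-\!\ast}\varphi$. For a set $X$, the set $\mathcal{B}(X)$ of bunches over $X$ is generated by $\Gamma ::= x\in X \mid \varnothing_{+} \mid \varnothing_{\times} \mid (\Gamma ; \Gamma) \mid (\Gamma , \Gamma)$; here $;$ is the additive context-former with unit $\varnothing_+$, and $,$ is the multiplicative context-former with unit $\varnothing_\times$. $\Gamma(\Delta)$ denotes a bunch with a distinguished sub-bunch occurrence $\Delta$, and $\Gamma(\Delta')$ the result of replacing that occurrence by $\Delta'$. A contextual bunch over $X$ is a function $\mathcal{B}(X)\to\mathcal{B}(X)$ of the form $\Sigma\mapsto\Gamma(\Sigma)$ (equivalently, a bunch with exactly one hole), written $\Gamma(\cdot)$; the set of these is $\dot{\mathcal{B}}(X)$, and $(\cdot)$ denotes the identity. Coherent equivalence $\equiv$ is the least equivalence relation on $\mathcal{B}(X)$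 containing the commutative monoid equations for $;$ with unit $\varnothing_+$ and for $,$ with unit $\varnothing_\times$, and such that $\Delta\equiv\Delta'$ implies $\Gamma(\Delta)\equiv\Gamma(\Delta')$. **System $\mathsf{NBI}$.** A sequent is a pair $\Gamma\triangleright\varphi$ with $\Gamma\in\mathcal{B}(\mathbb{F})$, $\varphi\in\mathbb{F}$. $\Gamma\vdash\varphi$ means $\Gamma\triangleright\varphi$ is derivable by the rules (premisses $\Rightarrow$ conclusion): $\Rightarrow \varphi\triangleright\varphi$; $\Gamma'\triangleright\varphi \Rightarrow \Gamma\triangleright\varphi$ if $\Gamma\equiv\Gamma'$; $\Gamma(\Delta)\triangleright\varphi \Rightarrow \Gamma(\Delta;\Delta')\triangleright\varphi$; $\Gamma(\Delta;\Delta)\triangleright\varphi \Rightarrow \Gamma(\Delta)\triangleright\varphi$; $\Rightarrow \varnothing_\times\triangleright\top^\ast$; [$\Gamma(\varnothing_\times)\triangleright\chi$ and $\Delta\triangleright\top^\ast$] $\Rightarrow \Gamma(\Delta)\triangleright\chi$; $(\Gamma,\varphi)\triangleright\psi \Rightarrow \Gamma\triangleright\varphi\mathbin{-\!\ast}\psi$; [$\Gamma\triangleright\varphi\mathbin{-\!\ast}\psi$ and $\Delta\triangleright\varphi$] $\Rightarrow (\Gamma,\Delta)\triangleright\psi$; [$\Gamma\triangleright\varphi$ and $\Delta\triangleright\psi$] $\Rightarrow (\Gamma,\Delta)\triangleright\varphi\ast\psi$; [$\Gamma(\varphi,\psi)\triangleright\chi$ and $\Delta\triangleright\varphi\ast\psi$]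 $\Rightarrow \Gamma(\Delta)\triangleright\chi$; $\Rightarrow \varnothing_+\triangleright\top$; [$\Gamma(\varnothing_+)\triangleright\chi$ and $\Delta\triangleright\top$] $\Rightarrow \Gamma(\Delta)\triangleright\chi$; $(\Gamma;\varphi)\triangleright\psi \Rightarrow \Gamma\triangleright\varphi\to\psi$; [$\Gamma\triangleright\varphi\to\psi$ and $\Delta\triangleright\varphi$] $\Rightarrow (\Gamma;\Delta)\triangleright\psi$; [$\Gamma\triangleright\varphi$ and $\Delta\triangleright\psi$] $\Rightarrow (\Gamma;\Delta)\triangleright\varphi\land\psi$; [$\Gamma(\varphi;\psi)\triangleright\chi$ and $\Delta\triangleright\varphi\land\psi$] $\Rightarrow \Gamma(\Delta)\triangleright\chi$; $\Gamma\triangleright\varphi_i \Rightarrow \Gamma\triangleright\varphi_1\lor\varphi_2$ ($i\in\{1,2\}$); [$\Gamma(\varphi)\triangleright\chi$ and $\Gamma(\psi)\triangleright\chi$ and $\Delta\triangleright\varphi\lor\psi$] $\Rightarrow \Gamma(\Delta)\triangleright\chi$; $\Gamma\triangleright\bot \Rightarrow \Gamma\triangleright\varphi$. **Bases.** An atomic rule is a pair consisting of a finite (possibly empty) set of premisses $P_1\triangleright p_1,\dots,P_n\triangleright p_n$ and a conclusion $P\triangleright p$, with $P_i,P\in\mathcal{B}(\mathbb{A})$, $p_i,p\in\mathbb{A}$; rules are not closed under substitution. A base is a set of atomic rules; $\mathscr{C}$ extends $\mathscr{B}$ when $\mathscr{C}\supseteq\mathscr{B}$. Derivability $\vdash_{\mathscr{B}}$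 is the smallest relation between $\mathcal{B}(\mathbb{A})$ and $\mathbb{A}$ such that: $p\vdash_{\mathscr{B}}p$; if a rule of $\mathscr{B}$ has premisses $P_i\triangleright p_i$ ($i=1,\dots,n$, $n\ge 0$) and conclusion $P\triangleright p$, and $P_i\vdash_{\mathscr{B}}p_i$ for all $i$, then $P\vdash_{\mathscr{B}}p$; if $P(Q)\vdash_{\mathscr{B}}p$ then $P(Q;Q')\vdash_{\mathscr{B}}p$ for any $Q'\in\mathcal{B}(\mathbb{A})$; if $P(Q;Q)\vdash_{\mathscr{B}}p$ then $P(Q)\vdash_{\mathscr{B}}p$; if $P(Q)\vdash_{\mathscr{B}}p$ and $Q\equiv Q'$ then $P(Q')\vdash_{\mathscr{B}}p$; if $T\vdash_{\mathscr{B}}q$ and $S(q)\vdash_{\mathscr{B}}p$ then $S(T)\vdash_{\mathscr{B}}p$. **Bunch-extension.** $\succeq$ is the least transitive relation on bunches such that $\Gamma\succeq\Gamma'$ whenever $\Gamma$ is coherently equivalent to the result of replacing some sub-bunch occurrence $\Delta$ of $\Gamma'$ by $(\Delta;\Delta')$, for some bunch $\Delta'$. $\Gamma'\preceq\Gamma$ means $\Gamma\succeq\Gamma'$. **Support.** For a base $\mathscr{B}$, $S\in\mathcal{B}(\mathbb{A})$ and $R(\cdot)\in\dot{\mathcal{B}}(\mathbb{A})$, support of formulae, of bunches of formulae, and of sequents is defined inductively ($\mathscr{X}$ ranges over bases, $U(\cdot)$ over $\dot{\mathcal{B}}(\mathbb{A})$, $U,Q_1,Q_2$ over $\mathcal{B}(\mathbb{A})$,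 $p$ over $\mathbb{A}$): - $\Vdash^{S}_{\mathscr{B}}p$ iff $S\vdash_{\mathscr{B}}p$; - $\Vdash^{S}_{\mathscr{B}}\varphi\land\psi$ iff for all $\mathscr{X}\supseteq\mathscr{B}$, $U(\cdot)$, $p$: if $(\varphi;\psi)\Vdash^{U(\cdot)}_{\mathscr{X}}p$ then $\Vdash^{U(S)}_{\mathscr{X}}p$; - $\Vdash^{S}_{\mathscr{B}}\varphi\ast\psi$ iff for all $\mathscr{X}\supseteq\mathscr{B}$, $U(\cdot)$, $p$: if $(\varphi,\psi)\Vdash^{U(\cdot)}_{\mathscr{X}}p$ then $\Vdash^{U(S)}_{\mathscr{X}}p$; - $\Vdash^{S}_{\mathscr{B}}\varphi\lor\psi$ iff for all $\mathscr{X}\supseteq\mathscr{B}$, $U(\cdot)$, $p$: if $\varphi\Vdash^{U(\cdot)}_{\mathscr{X}}p$ and $\psi\Vdash^{U(\cdot)}_{\mathscr{X}}p$ then $\Vdash^{U(S)}_{\mathscr{X}}p$; - $\Vdash^{S}_{\mathscr{B}}\varphi\to\psi$ iff $\varphi\Vdash^{S;(\cdot)}_{\mathscr{B}}\psi$; - $\Vdash^{S}_{\mathscr{B}}\varphi\mathbin{-\!\ast}\psi$ iff $\varphi\Vdash^{S,(\cdot)}_{\mathscr{B}}\psi$; - $\Vdash^{S}_{\mathscr{B}}\bot$ iff for all $U(\cdot)$ and $p$: $\Vdash^{U(S)}_{\mathscr{B}}p$; - $\Vdash^{S}_{\mathscr{B}}\top$ iff for all $\mathscr{X}\supseteq\mathscr{B}$,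 $U(\cdot)$, $p$: if $\Vdash^{U(\varnothing_+)}_{\mathscr{X}}p$ then $\Vdash^{U(S)}_{\mathscr{X}}p$; - $\Vdash^{S}_{\mathscr{B}}\top^\ast$ iff for all $\mathscr{X}\supseteq\mathscr{B}$, $U(\cdot)$, $p$: if $\Vdash^{U(\varnothing_\times)}_{\mathscr{X}}p$ then $\Vdash^{U(S)}_{\mathscr{X}}p$; - $\Gamma\Vdash^{R(\cdot)}_{\mathscr{B}}\psi$ iff for all $\mathscr{X}\supseteq\mathscr{B}$ and $U$: if $\Vdash^{U}_{\mathscr{X}}\Gamma$ then $\Vdash^{R(U)}_{\mathscr{X}}\psi$; - $\Vdash^{S}_{\mathscr{B}}\varnothing_\times$ iff $S\succeq\varnothing_\times$; - $\Vdash^{S}_{\mathscr{B}}\varnothing_+$ always; - $\Vdash^{S}_{\mathscr{B}}(\Gamma,\Delta)$ iff there are $Q_1,Q_2$ with $S\succeq(Q_1,Q_2)$, $\Vdash^{Q_1}_{\mathscr{B}}\Gamma$ and $\Vdash^{Q_2}_{\mathscr{B}}\Delta$; - $\Vdash^{S}_{\mathscr{B}}(\Gamma;\Delta)$ iff there are $Q_1,Q_2$ with $S\succeq Q_1$, $S\succeq Q_2$, $\Vdash^{Q_1}_{\mathscr{B}}\Gamma$ and $\Vdash^{Q_2}_{\mathscr{B}}\Delta$. **Validity.** $\Gamma\Vdash\varphi$ iff $\Gamma\Vdash^{(\cdot)}_{\mathscr{B}}\varphi$ for every base $\mathscr{B}$. *)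

theory Defs
  imports Main "HOL-Library.FSet" "HOL-Library.Countable" "HOL-Library.Infinite_Typeclass"
begin

section \<open>Formulae, bunches and contextual bunches\<close>

text \<open>Atoms are the elements of a type variable; it is constrained to be countably infinite
  (sorts \<open>countable\<close> and \<open>infinite\<close>) only where that is used.\<close>

datatype 'a fm =
    Atom 'a
  | Top  ("\<^bold>\<top>")
  | Bot  ("\<^bold>\<bottom>")
  | MTop ("\<^bold>\<top>\<^sup>*")
  | And "'a fm" "'a fm"  (infixr "\<^bold>\<and>" 75)
  | Or "'a fm" "'a fm"   (infixr "\<^bold>\<or>" 74)
  | Imp "'a fm" "'a fm"  (infixr "\<^bold>\<rightarrow>" 73)
  | Star "'a fm" "'a fm" (infixr "\<^bold>*" 75)
  | Wand "'a fm" "'a fm" (infixr "\<^bold>-*" 73)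

datatype 'x bunch =
    Leaf 'x
  | AddUnit ("\<emptyset>\<^sub>+")
  | MulUnit ("\<emptyset>\<^sub>\<times>")
  | AddB "'x bunch" "'x bunch" (infixr ";;" 66)
  | MulB "'x bunch" "'x bunch" (infixr ",," 66)

text \<open>Bunches with exactly one hole; \<open>fill U \<Delta>\<close> is the bunch \<open>U(\<Delta>)\<close>, and a distinguished
  sub-bunch occurrence \<open>\<Delta>\<close> of \<open>\<Gamma>\<close> is a presentation of \<open>\<Gamma>\<close> as \<open>fill U \<Delta>\<close>.\<close>

datatype 'x bunch_ctx =
    Hole
  | AddL "'x bunch_ctx" "'x bunch"
  | AddR "'x bunch" "'x bunch_ctx"
  | MulL "'x bunch_ctx" "'x bunch"
  | MulR "'x bunch" "'x bunch_ctx"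

primrec fill :: "'x bunch_ctx \<Rightarrow> 'x bunch \<Rightarrow> 'x bunch" where
  "fill Hole \<Delta> = \<Delta>"
| "fill (AddL U \<Gamma>) \<Delta> = fill U \<Delta> ;; \<Gamma>"
| "fill (AddR \<Gamma> U) \<Delta> = \<Gamma> ;; fill U \<Delta>"
| "fill (MulL U \<Gamma>) \<Delta> = fill U \<Delta> ,, \<Gamma>"
| "fill (MulR \<Gamma> U) \<Delta> = \<Gamma> ,, fill U \<Delta>"

inductive coh :: "'x bunch \<Rightarrow> 'x bunch \<Rightarrow> bool" (infix "\<cong>\<^sub>c" 50) where
  coh_refl: "\<Gamma> \<cong>\<^sub>c \<Gamma>"
| coh_sym: "\<Gamma> \<cong>\<^sub>c \<Delta> \<Longrightarrow> \<Delta> \<cong>\<^sub>c \<Gamma>"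
| coh_trans: "\<Gamma> \<cong>\<^sub>c \<Delta> \<Longrightarrow> \<Delta> \<cong>\<^sub>c \<Theta> \<Longrightarrow> \<Gamma> \<cong>\<^sub>c \<Theta>"
| coh_add_assoc: "(\<Gamma> ;; \<Delta>) ;; \<Theta> \<cong>\<^sub>c \<Gamma> ;; (\<Delta> ;; \<Theta>)"
| coh_add_comm: "\<Gamma> ;; \<Delta> \<cong>\<^sub>c \<Delta> ;; \<Gamma>"
| coh_add_unit: "\<Gamma> ;; \<emptyset>\<^sub>+ \<cong>\<^sub>c \<Gamma>"
| coh_mul_assoc: "(\<Gamma> ,, \<Delta>) ,, \<Theta> \<cong>\<^sub>c \<Gamma> ,, (\<Delta> ,, \<Theta>)"
| coh_mul_comm: "\<Gamma> ,, \<Delta> \<cong>\<^sub>c \<Delta> ,, \<Gamma>"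
| coh_mul_unit: "\<Gamma> ,, \<emptyset>\<^sub>\<times> \<cong>\<^sub>c \<Gamma>"
| coh_cong: "\<Delta> \<cong>\<^sub>c \<Delta>' \<Longrightarrow> fill U \<Delta> \<cong>\<^sub>c fill U \<Delta>'"

text \<open>\<open>\<Gamma> \<succeq> \<Gamma>'\<close>: the bunch \<open>\<Gamma>\<close> extends \<open>\<Gamma>'\<close>. It is reflexive since \<open>\<Gamma> \<cong>\<^sub>c \<Gamma> ;; \<emptyset>\<^sub>+\<close>.\<close>

inductive bext :: "'x bunch \<Rightarrow> 'x bunch \<Rightarrow> bool" (infix "\<succeq>" 50) where
  bext_step: "\<Gamma> \<cong>\<^sub>c fill U (\<Delta> ;; \<Delta>') \<Longrightarrow> \<Gamma> \<succeq> fill U \<Delta>"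
| bext_trans: "\<Gamma> \<succeq> \<Gamma>' \<Longrightarrow> \<Gamma>' \<succeq> \<Gamma>'' \<Longrightarrow> \<Gamma> \<succeq> \<Gamma>''"


section \<open>The natural deduction system NBI\<close>

inductive nbi :: "'a fm bunch \<Rightarrow> 'a fm \<Rightarrow> bool" (infix "\<turnstile>\<^sub>N" 50) where
  ax: "Leaf \<phi> \<turnstile>\<^sub>N \<phi>"
| exch: "\<Gamma>' \<turnstile>\<^sub>N \<phi> \<Longrightarrow> \<Gamma> \<cong>\<^sub>c \<Gamma>' \<Longrightarrow> \<Gamma> \<turnstile>\<^sub>N \<phi>"
| weak: "fill U \<Delta> \<turnstile>\<^sub>N \<phi> \<Longrightarrow> fill U (\<Delta> ;; \<Delta>') \<turnstile>\<^sub>N \<phi>"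
| cont: "fill U (\<Delta> ;; \<Delta>) \<turnstile>\<^sub>N \<phi> \<Longrightarrow> fill U \<Delta> \<turnstile>\<^sub>N \<phi>"
| mtop_I: "\<emptyset>\<^sub>\<times> \<turnstile>\<^sub>N \<^bold>\<top>\<^sup>*"
| mtop_E: "fill U \<emptyset>\<^sub>\<times> \<turnstile>\<^sub>N \<chi> \<Longrightarrow> \<Delta> \<turnstile>\<^sub>N \<^bold>\<top>\<^sup>* \<Longrightarrow> fill U \<Delta> \<turnstile>\<^sub>N \<chi>"
| wand_I: "\<Gamma> ,, Leaf \<phi> \<turnstile>\<^sub>N \<psi> \<Longrightarrow> \<Gamma> \<turnstile>\<^sub>N \<phi> \<^bold>-* \<psi>"
| wand_E: "\<Gamma> \<turnstile>\<^sub>N \<phi> \<^bold>-* \<psi> \<Longrightarrow> \<Delta> \<turnstile>\<^sub>N \<phi> \<Longrightarrow> \<Gamma> ,, \<Delta> \<turnstile>\<^sub>N \<psi>"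
| star_I: "\<Gamma> \<turnstile>\<^sub>N \<phi> \<Longrightarrow> \<Delta> \<turnstile>\<^sub>N \<psi> \<Longrightarrow> \<Gamma> ,, \<Delta> \<turnstile>\<^sub>N \<phi> \<^bold>* \<psi>"
| star_E: "fill U (Leaf \<phi> ,, Leaf \<psi>) \<turnstile>\<^sub>N \<chi> \<Longrightarrow> \<Delta> \<turnstile>\<^sub>N \<phi> \<^bold>* \<psi> \<Longrightarrow> fill U \<Delta> \<turnstile>\<^sub>N \<chi>"
| top_I: "\<emptyset>\<^sub>+ \<turnstile>\<^sub>N \<^bold>\<top>"
| top_E: "fill U \<emptyset>\<^sub>+ \<turnstile>\<^sub>N \<chi> \<Longrightarrow> \<Delta> \<turnstile>\<^sub>N \<^bold>\<top> \<Longrightarrow> fill U \<Delta> \<turnstile>\<^sub>N \<chi>"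
| imp_I: "\<Gamma> ;; Leaf \<phi> \<turnstile>\<^sub>N \<psi> \<Longrightarrow> \<Gamma> \<turnstile>\<^sub>N \<phi> \<^bold>\<rightarrow> \<psi>"
| imp_E: "\<Gamma> \<turnstile>\<^sub>N \<phi> \<^bold>\<rightarrow> \<psi> \<Longrightarrow> \<Delta> \<turnstile>\<^sub>N \<phi> \<Longrightarrow> \<Gamma> ;; \<Delta> \<turnstile>\<^sub>N \<psi>"
| and_I: "\<Gamma> \<turnstile>\<^sub>N \<phi> \<Longrightarrow> \<Delta> \<turnstile>\<^sub>N \<psi> \<Longrightarrow> \<Gamma> ;; \<Delta> \<turnstile>\<^sub>N \<phi> \<^bold>\<and> \<psi>"
| and_E: "fill U (Leaf \<phi> ;; Leaf \<psi>) \<turnstile>\<^sub>N \<chi> \<Longrightarrow> \<Delta> \<turnstile>\<^sub>N \<phi> \<^bold>\<and> \<psi> \<Longrightarrow> fill U \<Delta> \<turnstile>\<^sub>N \<chi>"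
| or_I1: "\<Gamma> \<turnstile>\<^sub>N \<phi> \<Longrightarrow> \<Gamma> \<turnstile>\<^sub>N \<phi> \<^bold>\<or> \<psi>"
| or_I2: "\<Gamma> \<turnstile>\<^sub>N \<psi> \<Longrightarrow> \<Gamma> \<turnstile>\<^sub>N \<phi> \<^bold>\<or> \<psi>"
| or_E: "fill U (Leaf \<phi>) \<turnstile>\<^sub>N \<chi> \<Longrightarrow> fill U (Leaf \<psi>) \<turnstile>\<^sub>N \<chi> \<Longrightarrow> \<Delta> \<turnstile>\<^sub>N \<phi> \<^bold>\<or> \<psi> \<Longrightarrow> fill U \<Delta> \<turnstile>\<^sub>N \<chi>"
| bot_E: "\<Gamma> \<turnstile>\<^sub>N \<^bold>\<bottom> \<Longrightarrow> \<Gamma> \<turnstile>\<^sub>N \<phi>"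


section \<open>Bases and derivability in a base\<close>

text \<open>An atomic sequent \<open>P \<triangleright> p\<close> is the pair \<open>(P, p)\<close>; an atomic rule pairs the finite set of its
  premisses with its conclusion.\<close>

type_synonym 'a atomic_sequent = "'a bunch \<times> 'a"
type_synonym 'a atomic_rule = "'a atomic_sequent fset \<times> 'a atomic_sequent"
type_synonym 'a base = "'a atomic_rule set"

inductive base_deriv :: "'a base \<Rightarrow> 'a bunch \<Rightarrow> 'a \<Rightarrow> bool" for B :: "'a base" where
  bd_ref: "base_deriv B (Leaf p) p"
| bd_rule: "(prems, (P, p)) \<in> B \<Longrightarrow> (\<And>Q q. (Q, q) |\<in>| prems \<Longrightarrow> base_deriv B Q q) \<Longrightarrow> base_deriv B P p"
| bd_weak: "base_deriv B (fill P Q) p \<Longrightarrow> base_deriv B (fill P (Q ;; Q')) p"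
| bd_cont: "base_deriv B (fill P (Q ;; Q)) p \<Longrightarrow> base_deriv B (fill P Q) p"
| bd_exch: "base_deriv B (fill P Q) p \<Longrightarrow> Q \<cong>\<^sub>c Q' \<Longrightarrow> base_deriv B (fill P Q') p"
| bd_cut: "base_deriv B T q \<Longrightarrow> base_deriv B (fill S (Leaf q)) p \<Longrightarrow> base_deriv B (fill S T) p"


section \<open>Base-extension semantics\<close>

text \<open>The clauses of support refer to one another: \<open>supp B S \<phi>\<close> and \<open>bsupp B S \<Gamma>\<close> are support
  of a formula and of a bunch relative to the base \<open>B\<close> and the atomic bunch \<open>S\<close>, and
  \<open>ssupp B R \<Gamma> \<psi>\<close> is support of the sequent \<open>\<Gamma> \<triangleright> \<psi>\<close> relative to \<open>B\<close> and the contextual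
  bunch \<open>R\<close>. The recursion is on the weight of the formulae and bunches involved. Atoms weigh 0,
  since the clauses for \<open>\<^bold>\<and>\<close>, \<open>\<^bold>*\<close>, \<open>\<^bold>\<or>\<close>, \<open>\<^bold>\<bottom>\<close>, \<open>\<^bold>\<top>\<close> and \<open>\<^bold>\<top>\<^sup>*\<close> refer to support of arbitrary atoms.\<close>

primrec fweight :: "'a fm \<Rightarrow> nat" where
  "fweight (Atom p) = 0"
| "fweight \<^bold>\<top> = 1"
| "fweight \<^bold>\<bottom> = 1"
| "fweight \<^bold>\<top>\<^sup>* = 1"
| "fweight (\<phi> \<^bold>\<and> \<psi>) = fweight \<phi> + fweight \<psi> + 5"
| "fweight (\<phi> \<^bold>\<or> \<psi>) = fweight \<phi> + fweight \<psi> + 5"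
| "fweight (\<phi> \<^bold>\<rightarrow> \<psi>) = fweight \<phi> + fweight \<psi> + 5"
| "fweight (\<phi> \<^bold>* \<psi>) = fweight \<phi> + fweight \<psi> + 5"
| "fweight (\<phi> \<^bold>-* \<psi>) = fweight \<phi> + fweight \<psi> + 5"

primrec bweight :: "'a fm bunch \<Rightarrow> nat" where
  "bweight (Leaf \<phi>) = fweight \<phi> + 1"
| "bweight \<emptyset>\<^sub>+ = 0"
| "bweight \<emptyset>\<^sub>\<times> = 0"
| "bweight (\<Gamma> ;; \<Delta>) = bweight \<Gamma> + bweight \<Delta> + 1"
| "bweight (\<Gamma> ,, \<Delta>) = bweight \<Gamma> + bweight \<Delta> + 1"

function (sequential)
  supp :: "'a base \<Rightarrow> 'a bunch \<Rightarrow> 'a fm \<Rightarrow> bool" and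
  bsupp :: "'a base \<Rightarrow> 'a bunch \<Rightarrow> 'a fm bunch \<Rightarrow> bool" and
  ssupp :: "'a base \<Rightarrow> 'a bunch_ctx \<Rightarrow> 'a fm bunch \<Rightarrow> 'a fm \<Rightarrow> bool"
where
  "supp B S (Atom p) \<longleftrightarrow> base_deriv B S p"
| "supp B S (\<phi> \<^bold>\<and> \<psi>) \<longleftrightarrow>
     (\<forall>X U p. B \<subseteq> X \<longrightarrow> ssupp X U (Leaf \<phi> ;; Leaf \<psi>) (Atom p) \<longrightarrow> supp X (fill U S) (Atom p))"
| "supp B S (\<phi> \<^bold>* \<psi>) \<longleftrightarrow>
     (\<forall>X U p. B \<subseteq> X \<longrightarrow> ssupp X U (Leaf \<phi> ,, Leaf \<psi>) (Atom p) \<longrightarrow> supp X (fill U S) (Atom p))"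
| "supp B S (\<phi> \<^bold>\<or> \<psi>) \<longleftrightarrow>
     (\<forall>X U p. B \<subseteq> X \<longrightarrow> ssupp X U (Leaf \<phi>) (Atom p) \<and> ssupp X U (Leaf \<psi>) (Atom p)
        \<longrightarrow> supp X (fill U S) (Atom p))"
| "supp B S (\<phi> \<^bold>\<rightarrow> \<psi>) \<longleftrightarrow> ssupp B (AddR S Hole) (Leaf \<phi>) \<psi>"
| "supp B S (\<phi> \<^bold>-* \<psi>) \<longleftrightarrow> ssupp B (MulR S Hole) (Leaf \<phi>) \<psi>"
| "supp B S \<^bold>\<bottom> \<longleftrightarrow> (\<forall>U p. supp B (fill U S) (Atom p))"
| "supp B S \<^bold>\<top> \<longleftrightarrow>
     (\<forall>X U p. B \<subseteq> X \<longrightarrow> supp X (fill U \<emptyset>\<^sub>+) (Atom p) \<longrightarrow> supp X (fill U S) (Atom p))"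
| "supp B S \<^bold>\<top>\<^sup>* \<longleftrightarrow>
     (\<forall>X U p. B \<subseteq> X \<longrightarrow> supp X (fill U \<emptyset>\<^sub>\<times>) (Atom p) \<longrightarrow> supp X (fill U S) (Atom p))"
| "bsupp B S (Leaf \<phi>) \<longleftrightarrow> supp B S \<phi>"
| "bsupp B S \<emptyset>\<^sub>\<times> \<longleftrightarrow> S \<succeq> \<emptyset>\<^sub>\<times>"
| "bsupp B S \<emptyset>\<^sub>+ \<longleftrightarrow> True"
| "bsupp B S (\<Gamma> ,, \<Delta>) \<longleftrightarrow>
     (\<exists>Q1 Q2. S \<succeq> (Q1 ,, Q2) \<and> bsupp B Q1 \<Gamma> \<and> bsupp B Q2 \<Delta>)"
| "bsupp B S (\<Gamma> ;; \<Delta>) \<longleftrightarrow>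
     (\<exists>Q1 Q2. S \<succeq> Q1 \<and> S \<succeq> Q2 \<and> bsupp B Q1 \<Gamma> \<and> bsupp B Q2 \<Delta>)"
| "ssupp B R \<Gamma> \<psi> \<longleftrightarrow> (\<forall>X U. B \<subseteq> X \<longrightarrow> bsupp X U \<Gamma> \<longrightarrow> supp X (fill R U) \<psi>)"
  by pat_completeness auto
termination
  by (relation "measure (case_sum (\<lambda>(B, S, \<phi>). fweight \<phi>)
       (case_sum (\<lambda>(B, S, \<Gamma>). bweight \<Gamma>) (\<lambda>(B, R, \<Gamma>, \<psi>). bweight \<Gamma> + fweight \<psi> + 1)))") auto

definition valid :: "'a fm bunch \<Rightarrow> 'a fm \<Rightarrow> bool" (infix "\<tturnstile>" 50) where
  "\<Gamma> \<tturnstile> \<phi> \<longleftrightarrow> (\<forall>B. ssupp B Hole \<Gamma> \<phi>)"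

end

(* Completeness is proved by letting atoms name formulae. Let A be the finite set of atoms of the
   sequent; since atoms are infinite in number, every formula over A has a name (an atom p in A
   names itself), distinct formulae having distinct names, and conversely every atom can be read as
   some formula. Consider the base of all atomic rules that are admissible in NBI under this
   reading. Derivability in it is sound for NBI, cut being derivable through a disjunction, and in
   every base extending it support of a formula over A coincides with derivability of its name.
   Validity in this base, instantiated at the bunch of names of the given bunch, therefore yields
   an NBI proof. *)

theory Submission
  imports Defs
begin

section \<open>Composition of contexts and relabelling of bunches\<close>

lemma fill_fill: "\<exists>W. \<forall>\<Delta>. fill V (fill U \<Delta>) = fill W \<Delta>"
proof (induction V)
  case Hole
  show ?case by auto
next
  case (AddL V \<Gamma>)
  then obtain W where "\<forall>\<Delta>. fill V (fill U \<Delta>) = fill W \<Delta>" ..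
  then show ?case by (intro exI[of _ "AddL W \<Gamma>"]) simp
next
  case (AddR \<Gamma> V)
  then obtain W where "\<forall>\<Delta>. fill V (fill U \<Delta>) = fill W \<Delta>" ..
  then show ?case by (intro exI[of _ "AddR \<Gamma> W"]) simp
next
  case (MulL V \<Gamma>)
  then obtain W where "\<forall>\<Delta>. fill V (fill U \<Delta>) = fill W \<Delta>" ..
  then show ?case by (intro exI[of _ "MulL W \<Gamma>"]) simp
next
  case (MulR \<Gamma> V)
  then obtain W where "\<forall>\<Delta>. fill V (fill U \<Delta>) = fill W \<Delta>" ..
  then show ?case by (intro exI[of _ "MulR \<Gamma> W"]) simp
qed

lemma map_fill: "map_bunch f (fill U \<Delta>) = fill (map_bunch_ctx f U) (map_bunch f \<Delta>)"
  by (induction U) simp_all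

lemma coh_map: "\<Gamma> \<cong>\<^sub>c \<Delta> \<Longrightarrow> map_bunch f \<Gamma> \<cong>\<^sub>c map_bunch f \<Delta>"
  by (induction rule: coh.induct) (auto simp: map_fill intro: coh.intros)

section \<open>Bunch-extension and derivability in a base\<close>

lemma bext_refl: "\<Gamma> \<succeq> \<Gamma>"
  using bext_step[of \<Gamma> Hole \<Gamma> "\<emptyset>\<^sub>+"] by (simp add: coh_sym coh_add_unit)

lemma bext_unit: "\<Gamma> \<succeq> \<emptyset>\<^sub>+"
  using bext_step[of \<Gamma> Hole "\<emptyset>\<^sub>+" \<Gamma>] by (simp, meson coh.intros)

lemma bext_add1: "\<Gamma> ;; \<Delta> \<succeq> \<Gamma>"
  using bext_step[of "\<Gamma> ;; \<Delta>" Hole \<Gamma> \<Delta>] by (simp add: coh_refl)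

lemma bext_add2: "\<Gamma> ;; \<Delta> \<succeq> \<Delta>"
  using bext_step[of "\<Gamma> ;; \<Delta>" Hole \<Delta> \<Gamma>] by (simp add: coh_add_comm)

text \<open>One extension step is a weakening in the composite context \<open>W\<close>, followed by
  exchange along the coherent equivalence. The surrounding \<open>U\<close> allows one component of
  a larger bunch to be extended while the rest stays fixed.\<close>

lemma base_deriv_bext:
  "Q \<succeq> P \<Longrightarrow> base_deriv B (fill U P) p \<Longrightarrow> base_deriv B (fill U Q) p"
proof (induction arbitrary: U rule: bext.induct)
  case (bext_step \<Gamma> V \<Delta> \<Delta>')
  obtain W where W: "\<forall>\<Delta>. fill U (fill V \<Delta>) = fill W \<Delta>" using fill_fill[of U V] ..
  then have "base_deriv B (fill U (fill V (\<Delta> ;; \<Delta>'))) p"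
    using bext_step.prems by (simp add: bd_weak)
  then show ?case by (rule bd_exch) (rule coh_sym[OF bext_step.hyps])
qed blast

text \<open>Extending each component to \<open>P\<close> gives \<open>P ;; P\<close>, which
  contracts. This matches the additive clause of bunch support, where one bunch extends both
  witnesses separately.\<close>

lemma base_deriv_diag:
  assumes "base_deriv B (Q1 ;; Q2) p" "P \<succeq> Q1" "P \<succeq> Q2"
  shows "base_deriv B P p"
proof -
  have "base_deriv B (P ;; Q2) p"
    using base_deriv_bext[of P Q1 B "AddL Hole Q2"] assms by simp
  then have "base_deriv B (P ;; P) p"
    using base_deriv_bext[of P Q2 B "AddR P Hole"] assms by simp
  then show ?thesis using bd_cont[of B Hole P p] by simp
qed

section \<open>Derived rules of natural deduction\<close>

lemma nbi_cut: "\<Delta> \<turnstile>\<^sub>N \<phi> \<Longrightarrow> fill U (Leaf \<phi>) \<turnstile>\<^sub>N \<chi> \<Longrightarrow> fill U \<Delta> \<turnstile>\<^sub>N \<chi>"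
  \<comment> \<open>The disjunction is of \<open>\<phi>\<close> with itself, so both cases of the
    elimination are the same premiss.\<close>
  by (meson or_E or_I1)

lemma nbi_top: "\<Gamma> \<turnstile>\<^sub>N \<^bold>\<top>"
proof (rule exch)
  show "\<emptyset>\<^sub>+ ;; \<Gamma> \<turnstile>\<^sub>N \<^bold>\<top>" using weak[of Hole "\<emptyset>\<^sub>+" "\<^bold>\<top>" \<Gamma>] by (simp add: top_I)
  show "\<Gamma> \<cong>\<^sub>c \<emptyset>\<^sub>+ ;; \<Gamma>" by (meson coh.intros)
qed

text \<open>The rule \<open>bot_E\<close> acts only on the whole bunch. To pass one layer of
  context, absurdity is used to prove an implication or wand from \<top> to \<open>\<phi>\<close>,
  which is then applied to the sibling bunch, since every bunch proves \<top>.\<close>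

lemma nbi_bot_fill: "\<Delta> \<turnstile>\<^sub>N \<^bold>\<bottom> \<Longrightarrow> fill U \<Delta> \<turnstile>\<^sub>N \<phi>"
proof (induction U arbitrary: \<phi>)
  case Hole
  then show ?case by (simp add: bot_E)
next
  case (AddL U \<Gamma> \<phi>)
  then show ?case using imp_E[of _ "\<^bold>\<top>" \<phi> \<Gamma>] nbi_top by auto
next
  case (AddR \<Gamma> U \<phi>)
  then have "fill U \<Delta> ;; \<Gamma> \<turnstile>\<^sub>N \<phi>" using imp_E[of _ "\<^bold>\<top>" \<phi> \<Gamma>] nbi_top by auto
  then show ?case unfolding fill.simps by (rule exch[OF _ coh_add_comm])
next
  case (MulL U \<Gamma> \<phi>)
  then show ?case using wand_E[of _ "\<^bold>\<top>" \<phi> \<Gamma>] nbi_top by auto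
next
  case (MulR \<Gamma> U \<phi>)
  then have "fill U \<Delta> ,, \<Gamma> \<turnstile>\<^sub>N \<phi>" using wand_E[of _ "\<^bold>\<top>" \<phi> \<Gamma>] nbi_top by auto
  then show ?case unfolding fill.simps by (rule exch[OF _ coh_mul_comm])
qed

section \<open>The base of admissible rules\<close>

definition admissible_base :: "('a \<Rightarrow> 'a fm) \<Rightarrow> 'a base" where
  "admissible_base \<nu> = {(prems, (P, p)).
     (\<forall>(Q, q) \<in> fset prems. map_bunch \<nu> Q \<turnstile>\<^sub>N \<nu> q) \<longrightarrow> map_bunch \<nu> P \<turnstile>\<^sub>N \<nu> p}"

lemma admissible_base_sound:
  "base_deriv (admissible_base \<nu>) P p \<Longrightarrow> map_bunch \<nu> P \<turnstile>\<^sub>N \<nu> p"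
proof (induction rule: base_deriv.induct)
  case (bd_ref p)
  show ?case by (simp add: ax)
next
  case (bd_rule prems P p)
  then show ?case by (auto simp: admissible_base_def)
next
  case (bd_weak P Q p Q')
  then show ?case by (simp add: map_fill weak)
next
  case (bd_cont P Q p)
  show ?case using bd_cont.IH unfolding map_fill bunch.map by (rule cont)
next
  case (bd_exch P Q p Q')
  then show ?case
    using exch[OF _ coh_cong[OF coh_sym[OF coh_map[OF bd_exch.hyps(2)]]]] by (simp add: map_fill)
next
  case (bd_cut T q S p)
  then show ?case by (simp add: map_fill nbi_cut)
qed

text \<open>An extension \<open>X\<close> may derive more than NBI proves, but it still contains
  every admissible rule. Hence each logical rule, read through \<open>\<nu>\<close>, can be applied
  in \<open>X\<close> to premisses derived there by any means. Premisses form a list so that each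
  use can write them out explicitly.\<close>

lemma base_deriv_admissible:
  assumes "admissible_base \<nu> \<subseteq> X"
    and "\<forall>(Q, q) \<in> set prems. base_deriv X Q q"
    and "\<forall>(Q, q) \<in> set prems. map_bunch \<nu> Q \<turnstile>\<^sub>N \<nu> q \<Longrightarrow> map_bunch \<nu> P \<turnstile>\<^sub>N \<nu> p"
  shows "base_deriv X P p"
proof (rule bd_rule)
  show "(fset_of_list prems, (P, p)) \<in> X"
    using assms(1,3) by (auto simp: admissible_base_def fset_of_list.rep_eq)
qed (use assms(2) in \<open>auto simp: fset_of_list_elem\<close>)

section \<open>Support as derivability of names\<close>

lemma base_deriv_mono: "base_deriv B P p \<Longrightarrow> B \<subseteq> X \<Longrightarrow> base_deriv X P p"
  by (induction rule: base_deriv.induct) (auto intro: base_deriv.intros)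

text \<open>The clauses for conjunctions, disjunction and the multiplicative unit have the shape of
  elimination rules. Forwards, they are tested on \<open>Hole\<close> and the name of the formula
  itself, where the introduction rule verifies the test; backwards, the elimination rule is
  admissible. Implication and wand use introduction forwards and elimination backwards directly.
  \<open>B\<close> varies in the induction because the clauses pass to extensions.\<close>

lemma supp_iff_base_deriv:
  assumes "\<And>\<phi>. set_fm \<phi> \<subseteq> A \<Longrightarrow> \<nu> (\<eta> \<phi>) = \<phi>"
    and "\<And>p. p \<in> A \<Longrightarrow> \<eta> (Atom p) = p"
    and "set_fm \<phi> \<subseteq> A" "admissible_base \<nu> \<subseteq> B"
  shows "supp B S \<phi> \<longleftrightarrow> base_deriv B S (\<eta> \<phi>)"
  using assms(3,4)
proof (induction \<phi> arbitrary: B S)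
  case (Atom p)
  then show ?case using assms(2) by simp
next
  case Top
  have \<nu>: "\<nu> (\<eta> \<^bold>\<top>) = \<^bold>\<top>" by (simp add: assms(1))
  \<comment> \<open>Both sides hold outright: the name by a rule without premisses, the support
    because every bunch extends the additive unit.\<close>
  have "base_deriv B S (\<eta> \<^bold>\<top>)"
    by (rule base_deriv_admissible[OF Top.prems(2), of "[]"]) (simp_all add: \<nu> nbi_top)
  then show ?case using base_deriv_bext[OF bext_unit] by auto
next
  case Bot
  have \<nu>: "\<nu> (\<eta> \<^bold>\<bottom>) = \<^bold>\<bottom>" by (simp add: assms(1))
  \<comment> \<open>The atom \<open>p\<close> is read as the formula \<open>\<nu> p\<close>,
    whatever it is, so absurdity must yield every formula under every context.\<close>
  have "base_deriv B (fill U S) p" if "base_deriv B S (\<eta> \<^bold>\<bottom>)" for U p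
    by (rule base_deriv_admissible[OF Bot.prems(2), of "[(S, \<eta> \<^bold>\<bottom>)]"])
      (use that in \<open>simp_all add: \<nu> map_fill nbi_bot_fill\<close>)
  moreover have "base_deriv B S (\<eta> \<^bold>\<bottom>)" if "\<And>U p. base_deriv B (fill U S) p"
    using that[of Hole] by simp
  ultimately show ?case by auto
next
  case MTop
  have \<nu>: "\<nu> (\<eta> \<^bold>\<top>\<^sup>*) = \<^bold>\<top>\<^sup>*" by (simp add: assms(1))
  show ?case
  proof
    assume "supp B S \<^bold>\<top>\<^sup>*"
    moreover have "base_deriv B (fill Hole \<emptyset>\<^sub>\<times>) (\<eta> \<^bold>\<top>\<^sup>*)"
      by (rule base_deriv_admissible[OF MTop.prems(2), of "[]"]) (simp_all add: \<nu> mtop_I)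
    ultimately have "base_deriv B (fill Hole S) (\<eta> \<^bold>\<top>\<^sup>*)"
      by (simp only: supp.simps)
    then show "base_deriv B S (\<eta> \<^bold>\<top>\<^sup>*)" by simp
  next
    assume S: "base_deriv B S (\<eta> \<^bold>\<top>\<^sup>*)"
    have "base_deriv X (fill U S) p" if X: "B \<subseteq> X" and "base_deriv X (fill U \<emptyset>\<^sub>\<times>) p" for X U p
      by (rule base_deriv_admissible[of \<nu> X "[(fill U \<emptyset>\<^sub>\<times>, p), (S, \<eta> \<^bold>\<top>\<^sup>*)]"])
        (use that MTop.prems(2) base_deriv_mono[OF S X] in \<open>auto simp: \<nu> map_fill intro: mtop_E\<close>)
    then show "supp B S \<^bold>\<top>\<^sup>*" by simp
  qed
next
  case (And \<phi> \<psi>)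
  then have \<nu>: "\<nu> (\<eta> \<phi>) = \<phi>" "\<nu> (\<eta> \<psi>) = \<psi>" "\<nu> (\<eta> (\<phi> \<^bold>\<and> \<psi>)) = \<phi> \<^bold>\<and> \<psi>"
    by (simp_all add: assms(1))
  have IH: "supp X S \<phi> \<longleftrightarrow> base_deriv X S (\<eta> \<phi>)" "supp X S \<psi> \<longleftrightarrow> base_deriv X S (\<eta> \<psi>)"
    if "B \<subseteq> X" for X S using And that by auto
  show ?case
  proof
    \<comment> \<open>Any \<open>V\<close> supporting the pair of conjuncts derives the name of the
      conjunction, which makes this name a suitable test atom.\<close>
    have "base_deriv X V (\<eta> (\<phi> \<^bold>\<and> \<psi>))"
      if X: "B \<subseteq> X" and V: "V \<succeq> Q1" "V \<succeq> Q2" and Q: "supp X Q1 \<phi>" "supp X Q2 \<psi>" for X V Q1 Q2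
    proof (rule base_deriv_diag[OF _ V])
      show "base_deriv X (Q1 ;; Q2) (\<eta> (\<phi> \<^bold>\<and> \<psi>))"
        by (rule base_deriv_admissible[of \<nu> X "[(Q1, \<eta> \<phi>), (Q2, \<eta> \<psi>)]"])
          (use Q X And.prems(2) in \<open>auto simp: \<nu> IH intro: and_I\<close>)
    qed
    then have "ssupp B Hole (Leaf \<phi> ;; Leaf \<psi>) (Atom (\<eta> (\<phi> \<^bold>\<and> \<psi>)))" by auto
    moreover assume "supp B S (\<phi> \<^bold>\<and> \<psi>)"
    ultimately have "supp B (fill Hole S) (Atom (\<eta> (\<phi> \<^bold>\<and> \<psi>)))"
      unfolding supp.simps(2) by blast
    then show "base_deriv B S (\<eta> (\<phi> \<^bold>\<and> \<psi>))" by simp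
  next
    assume S: "base_deriv B S (\<eta> (\<phi> \<^bold>\<and> \<psi>))"
    have "supp X (fill U S) (Atom p)"
      if X: "B \<subseteq> X" and U: "ssupp X U (Leaf \<phi> ;; Leaf \<psi>) (Atom p)" for X U p
    proof -
      \<comment> \<open>The two names are a generic instance: what they derive under
        \<open>U\<close> is exactly the minor premiss of the elimination rule.\<close>
      have "bsupp X (Leaf (\<eta> \<phi>) ;; Leaf (\<eta> \<psi>)) (Leaf \<phi> ;; Leaf \<psi>)"
        unfolding bsupp.simps IH[OF X]
        by (intro exI conjI, rule bext_add1, rule bext_add2) (rule bd_ref)+
      then have "base_deriv X (fill U (Leaf (\<eta> \<phi>) ;; Leaf (\<eta> \<psi>))) p"
        using U unfolding ssupp.simps supp.simps(1) by blast
      then have "base_deriv X (fill U S) p"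
        by (intro base_deriv_admissible[of \<nu> X
              "[(fill U (Leaf (\<eta> \<phi>) ;; Leaf (\<eta> \<psi>)), p), (S, \<eta> (\<phi> \<^bold>\<and> \<psi>))]"])
          (use X And.prems(2) base_deriv_mono[OF S X] in \<open>auto simp: \<nu> map_fill intro: and_E\<close>)
      then show ?thesis by simp
    qed
    then show "supp B S (\<phi> \<^bold>\<and> \<psi>)" unfolding supp.simps(2) by blast
  qed
next
  case (Or \<phi> \<psi>)
  then have \<nu>: "\<nu> (\<eta> \<phi>) = \<phi>" "\<nu> (\<eta> \<psi>) = \<psi>" "\<nu> (\<eta> (\<phi> \<^bold>\<or> \<psi>)) = \<phi> \<^bold>\<or> \<psi>"
    by (simp_all add: assms(1))
  have IH: "supp X S \<phi> \<longleftrightarrow> base_deriv X S (\<eta> \<phi>)" "supp X S \<psi> \<longleftrightarrow> base_deriv X S (\<eta> \<psi>)"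
    if "B \<subseteq> X" for X S using Or that by auto
  show ?case
  proof
    have "base_deriv X V (\<eta> (\<phi> \<^bold>\<or> \<psi>))" if X: "B \<subseteq> X" and V: "supp X V \<phi>" for X V
      by (rule base_deriv_admissible[of \<nu> X "[(V, \<eta> \<phi>)]"])
        (use V X Or.prems(2) in \<open>auto simp: \<nu> IH intro: or_I1\<close>)
    then have "ssupp B Hole (Leaf \<phi>) (Atom (\<eta> (\<phi> \<^bold>\<or> \<psi>)))" by auto
    moreover have "base_deriv X V (\<eta> (\<phi> \<^bold>\<or> \<psi>))" if X: "B \<subseteq> X" and V: "supp X V \<psi>" for X V
      by (rule base_deriv_admissible[of \<nu> X "[(V, \<eta> \<psi>)]"])
        (use V X Or.prems(2) in \<open>auto simp: \<nu> IH intro: or_I2\<close>)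
    then have "ssupp B Hole (Leaf \<psi>) (Atom (\<eta> (\<phi> \<^bold>\<or> \<psi>)))" by auto
    moreover assume "supp B S (\<phi> \<^bold>\<or> \<psi>)"
    ultimately have "supp B (fill Hole S) (Atom (\<eta> (\<phi> \<^bold>\<or> \<psi>)))"
      unfolding supp.simps(4) by blast
    then show "base_deriv B S (\<eta> (\<phi> \<^bold>\<or> \<psi>))" by simp
  next
    assume S: "base_deriv B S (\<eta> (\<phi> \<^bold>\<or> \<psi>))"
    have "supp X (fill U S) (Atom p)"
      if X: "B \<subseteq> X" and U: "ssupp X U (Leaf \<phi>) (Atom p)" "ssupp X U (Leaf \<psi>) (Atom p)" for X U p
    proof -
      have "base_deriv X (fill U (Leaf (\<eta> \<phi>))) p" "base_deriv X (fill U (Leaf (\<eta> \<psi>))) p"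
        using U by (simp_all add: IH[OF X] bd_ref)
      then have "base_deriv X (fill U S) p"
        by (intro base_deriv_admissible[of \<nu> X
              "[(fill U (Leaf (\<eta> \<phi>)), p), (fill U (Leaf (\<eta> \<psi>)), p), (S, \<eta> (\<phi> \<^bold>\<or> \<psi>))]"])
          (use X Or.prems(2) base_deriv_mono[OF S X] in \<open>auto simp: \<nu> map_fill intro: or_E\<close>)
      then show ?thesis by simp
    qed
    then show "supp B S (\<phi> \<^bold>\<or> \<psi>)" unfolding supp.simps(4) by blast
  qed
next
  case (Imp \<phi> \<psi>)
  then have \<nu>: "\<nu> (\<eta> \<phi>) = \<phi>" "\<nu> (\<eta> \<psi>) = \<psi>" "\<nu> (\<eta> (\<phi> \<^bold>\<rightarrow> \<psi>)) = \<phi> \<^bold>\<rightarrow> \<psi>"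
    by (simp_all add: assms(1))
  have IH: "supp X S \<phi> \<longleftrightarrow> base_deriv X S (\<eta> \<phi>)" "supp X S \<psi> \<longleftrightarrow> base_deriv X S (\<eta> \<psi>)"
    if "B \<subseteq> X" for X S using Imp that by auto
  show ?case
  proof
    assume "supp B S (\<phi> \<^bold>\<rightarrow> \<psi>)"
    \<comment> \<open>The support of \<open>\<phi>\<close> is instantiated at its own name, which
      plays the discharged assumption.\<close>
    then have "base_deriv B (S ;; Leaf (\<eta> \<phi>)) (\<eta> \<psi>)"
      by (auto simp: IH bd_ref)
    then show "base_deriv B S (\<eta> (\<phi> \<^bold>\<rightarrow> \<psi>))"
      by (intro base_deriv_admissible[of \<nu> B "[(S ;; Leaf (\<eta> \<phi>), \<eta> \<psi>)]"])
        (use Imp.prems(2) in \<open>auto simp: \<nu> intro: imp_I\<close>)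
  next
    assume S: "base_deriv B S (\<eta> (\<phi> \<^bold>\<rightarrow> \<psi>))"
    have "base_deriv X (S ;; V) (\<eta> \<psi>)" if X: "B \<subseteq> X" and V: "base_deriv X V (\<eta> \<phi>)" for X V
      by (rule base_deriv_admissible[of \<nu> X "[(S, \<eta> (\<phi> \<^bold>\<rightarrow> \<psi>)), (V, \<eta> \<phi>)]"])
        (use V X Imp.prems(2) base_deriv_mono[OF S X] in \<open>auto simp: \<nu> intro: imp_E\<close>)
    then show "supp B S (\<phi> \<^bold>\<rightarrow> \<psi>)" by (auto simp: IH)
  qed
next
  case (Star \<phi> \<psi>)
  then have \<nu>: "\<nu> (\<eta> \<phi>) = \<phi>" "\<nu> (\<eta> \<psi>) = \<psi>" "\<nu> (\<eta> (\<phi> \<^bold>* \<psi>)) = \<phi> \<^bold>* \<psi>"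
    by (simp_all add: assms(1))
  have IH: "supp X S \<phi> \<longleftrightarrow> base_deriv X S (\<eta> \<phi>)" "supp X S \<psi> \<longleftrightarrow> base_deriv X S (\<eta> \<psi>)"
    if "B \<subseteq> X" for X S using Star that by auto
  show ?case
  proof
    have "base_deriv X V (\<eta> (\<phi> \<^bold>* \<psi>))"
      if X: "B \<subseteq> X" and V: "V \<succeq> Q1 ,, Q2" and Q: "supp X Q1 \<phi>" "supp X Q2 \<psi>" for X V Q1 Q2
    proof -
      \<comment> \<open>Here \<open>V\<close> extends the combination of the witnesses as a whole,
        so a single transfer along the extension replaces the contraction used for \<and>.\<close>
      have "base_deriv X (Q1 ,, Q2) (\<eta> (\<phi> \<^bold>* \<psi>))"
        by (rule base_deriv_admissible[of \<nu> X "[(Q1, \<eta> \<phi>), (Q2, \<eta> \<psi>)]"])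
          (use Q X Star.prems(2) in \<open>auto simp: \<nu> IH intro: star_I\<close>)
      then show ?thesis using base_deriv_bext[OF V, of X Hole] by simp
    qed
    then have "ssupp B Hole (Leaf \<phi> ,, Leaf \<psi>) (Atom (\<eta> (\<phi> \<^bold>* \<psi>)))" by auto
    moreover assume "supp B S (\<phi> \<^bold>* \<psi>)"
    ultimately have "supp B (fill Hole S) (Atom (\<eta> (\<phi> \<^bold>* \<psi>)))"
      unfolding supp.simps(3) by blast
    then show "base_deriv B S (\<eta> (\<phi> \<^bold>* \<psi>))" by simp
  next
    assume S: "base_deriv B S (\<eta> (\<phi> \<^bold>* \<psi>))"
    have "supp X (fill U S) (Atom p)"
      if X: "B \<subseteq> X" and U: "ssupp X U (Leaf \<phi> ,, Leaf \<psi>) (Atom p)" for X U p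
    proof -
      have "bsupp X (Leaf (\<eta> \<phi>) ,, Leaf (\<eta> \<psi>)) (Leaf \<phi> ,, Leaf \<psi>)"
        unfolding bsupp.simps IH[OF X] by (intro exI conjI, rule bext_refl) (rule bd_ref)+
      then have "base_deriv X (fill U (Leaf (\<eta> \<phi>) ,, Leaf (\<eta> \<psi>))) p"
        using U unfolding ssupp.simps supp.simps(1) by blast
      then have "base_deriv X (fill U S) p"
        by (intro base_deriv_admissible[of \<nu> X
              "[(fill U (Leaf (\<eta> \<phi>) ,, Leaf (\<eta> \<psi>)), p), (S, \<eta> (\<phi> \<^bold>* \<psi>))]"])
          (use X Star.prems(2) base_deriv_mono[OF S X] in \<open>auto simp: \<nu> map_fill intro: star_E\<close>)
      then show ?thesis by simp
    qed
    then show "supp B S (\<phi> \<^bold>* \<psi>)" unfolding supp.simps(3) by blast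
  qed
next
  case (Wand \<phi> \<psi>)
  then have \<nu>: "\<nu> (\<eta> \<phi>) = \<phi>" "\<nu> (\<eta> \<psi>) = \<psi>" "\<nu> (\<eta> (\<phi> \<^bold>-* \<psi>)) = \<phi> \<^bold>-* \<psi>"
    by (simp_all add: assms(1))
  have IH: "supp X S \<phi> \<longleftrightarrow> base_deriv X S (\<eta> \<phi>)" "supp X S \<psi> \<longleftrightarrow> base_deriv X S (\<eta> \<psi>)"
    if "B \<subseteq> X" for X S using Wand that by auto
  show ?case
  proof
    assume "supp B S (\<phi> \<^bold>-* \<psi>)"
    then have "base_deriv B (S ,, Leaf (\<eta> \<phi>)) (\<eta> \<psi>)"
      by (auto simp: IH bd_ref)
    then show "base_deriv B S (\<eta> (\<phi> \<^bold>-* \<psi>))"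
      by (intro base_deriv_admissible[of \<nu> B "[(S ,, Leaf (\<eta> \<phi>), \<eta> \<psi>)]"])
        (use Wand.prems(2) in \<open>auto simp: \<nu> intro: wand_I\<close>)
  next
    assume S: "base_deriv B S (\<eta> (\<phi> \<^bold>-* \<psi>))"
    have "base_deriv X (S ,, V) (\<eta> \<psi>)" if X: "B \<subseteq> X" and V: "base_deriv X V (\<eta> \<phi>)" for X V
      by (rule base_deriv_admissible[of \<nu> X "[(S, \<eta> (\<phi> \<^bold>-* \<psi>)), (V, \<eta> \<phi>)]"])
        (use V X Wand.prems(2) base_deriv_mono[OF S X] in \<open>auto simp: \<nu> intro: wand_E\<close>)
    then show "supp B S (\<phi> \<^bold>-* \<psi>)" by (auto simp: IH)
  qed
qed

text \<open>The renamed sub-bunches are the witnesses: \<open>;;\<close> extends each of its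
  components, and \<open>,,\<close> extends itself.\<close>

lemma bsupp_map:
  assumes "\<And>\<phi>. \<phi> \<in> set_bunch \<Gamma> \<Longrightarrow> supp B (Leaf (\<eta> \<phi>)) \<phi>"
  shows "bsupp B (map_bunch \<eta> \<Gamma>) \<Gamma>"
  using assms
proof (induction \<Gamma>)
  case (AddB \<Gamma> \<Delta>)
  then show ?case using bext_add1 bext_add2 by fastforce
next
  case (MulB \<Gamma> \<Delta>)
  then show ?case using bext_refl by fastforce
qed (auto simp: bext_refl)

section \<open>Naming formulae by atoms\<close>

lemma finite_set_fm: "finite (set_fm \<phi>)"
  by (induction \<phi>) simp_all

lemma finite_set_bunch: "finite (set_bunch \<Gamma>)"
  by (induction \<Gamma>) simp_all

instance fm :: (countable) countable
  by countable_datatype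

text \<open>Injectivity is claimed only for formulae over \<open>A\<close>, since an atom outside
  \<open>A\<close> names itself and may also be the code of a compound formula.\<close>

lemma ex_naming:
  fixes A :: "'a :: {countable, infinite} set"
  assumes "finite A"
  obtains \<eta> :: "'a fm \<Rightarrow> 'a" and \<nu>
  where "\<And>\<phi>. set_fm \<phi> \<subseteq> A \<Longrightarrow> \<nu> (\<eta> \<phi>) = \<phi>" "\<And>p. \<eta> (Atom p) = p"
proof -
  have "infinite (- A)" using assms by (simp add: infinite_UNIV)
  then obtain f :: "nat \<Rightarrow> 'a" where f: "inj f" "range f \<subseteq> - A"
    using infinite_countable_subset by blast
  \<comment> \<open>Codes of non-atomic formulae lie outside \<open>A\<close>, so they never clash
    with atoms of \<open>A\<close>.\<close>
  define \<eta> :: "'a fm \<Rightarrow> 'a" where "\<eta> \<phi> = (case \<phi> of Atom p \<Rightarrow> p | _ \<Rightarrow> f (to_nat \<phi>))" for \<phi>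
  have f_notin: "f n \<notin> A" for n using f(2) by blast
  have "inj_on \<eta> {\<phi>. set_fm \<phi> \<subseteq> A}"
  proof (rule inj_onI, simp)
    fix \<phi> \<psi> :: "'a fm"
    assume "set_fm \<phi> \<subseteq> A" "set_fm \<psi> \<subseteq> A" "\<eta> \<phi> = \<eta> \<psi>"
    then show "\<phi> = \<psi>"
      using f_notin by (cases \<phi>; cases \<psi>; force simp: \<eta>_def inj_eq[OF f(1)])
  qed
  then have "inv_into {\<phi>. set_fm \<phi> \<subseteq> A} \<eta> (\<eta> \<phi>) = \<phi>" if "set_fm \<phi> \<subseteq> A" for \<phi>
    using that by (simp add: inv_into_f_f)
  moreover have "\<eta> (Atom p) = p" for p by (simp add: \<eta>_def)
  ultimately show thesis by (rule that)
qed

section \<open>Completeness by reading names back as formulae\<close>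

theorem theorem6p1:
  fixes \<Gamma> :: "'a :: {countable, infinite} fm bunch" and \<phi> :: "'a fm"
  assumes "\<Gamma> \<tturnstile> \<phi>"
  shows "\<Gamma> \<turnstile>\<^sub>N \<phi>"
proof -
  define A where "A = set_fm \<phi> \<union> (\<Union>\<psi> \<in> set_bunch \<Gamma>. set_fm \<psi>)"
  have "finite A" by (simp add: A_def finite_set_fm finite_set_bunch)
  then obtain \<eta> :: "'a fm \<Rightarrow> 'a" and \<nu>
    where \<nu>: "\<And>\<phi>. set_fm \<phi> \<subseteq> A \<Longrightarrow> \<nu> (\<eta> \<phi>) = \<phi>" and \<eta>: "\<And>p. \<eta> (Atom p) = p"
    by (rule ex_naming) (rule that)
  let ?B = "admissible_base \<nu>"
  note iff = supp_iff_base_deriv[OF \<nu> \<eta> _ subset_refl]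
  have in_A: "set_fm \<psi> \<subseteq> A" if "\<psi> \<in> set_bunch \<Gamma>" for \<psi>
    using that by (auto simp: A_def)
  have \<phi>_in_A: "set_fm \<phi> \<subseteq> A" by (simp add: A_def)
  \<comment> \<open>Each name derives itself, hence supports the formula it names.\<close>
  have "bsupp ?B (map_bunch \<eta> \<Gamma>) \<Gamma>"
    by (rule bsupp_map) (simp add: iff in_A bd_ref)
  then have "supp ?B (map_bunch \<eta> \<Gamma>) \<phi>"
    using assms by (auto simp: valid_def)
  then have "map_bunch \<nu> (map_bunch \<eta> \<Gamma>) \<turnstile>\<^sub>N \<nu> (\<eta> \<phi>)"
    by (simp add: iff \<phi>_in_A admissible_base_sound)
  \<comment> \<open>All leaves are formulae over \<open>A\<close>, where \<open>\<nu>\<close> undoes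
    \<open>\<eta>\<close>.\<close>
  moreover have "map_bunch \<nu> (map_bunch \<eta> \<Gamma>) = map_bunch id \<Gamma>"
    unfolding bunch.map_comp by (rule bunch.map_cong0) (simp add: in_A \<nu>)
  ultimately show ?thesis by (simp add: \<nu> \<phi>_in_A bunch.map_id)
qed

end
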